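(* (Group Law) Let $z\in\mathbb{C}\setminus\{0\}$. For $u,v,w,y\in\mathbb{C}$ define $$g(u,v,w,y):=e^{u\,a^\dagger}\,e^{v\,h}\,e^{w\,a}\,e^{y\,E}.$$ Then the family of operators of this form is a group with group law given by $$g(\alpha,\beta,\gamma,\delta)\,g(A,B,C,D)=g\left(\alpha+A,\ \beta+B+\gamma A,\ \gamma+C,\ \left(\frac{\gamma A^2}{2}+\beta A\right)z+\left(\frac{\gamma^2A}{2}+\gamma B\right)\bar z+\delta+D\right).$$ The family of operators $g(u,v,w,y)$ with $u,v,w\in\mathbb{R}$ and $y\in\mathbb{C}$ is a subgroup. The group $\mathbb{R}^3\times\mathbb{C}$ endowed with the composition law $$(\alpha,\beta,\gamma,\delta)\,(A,B,C,D)=\left(\alpha+A,\ \beta+B+\gamma A,\ \gamma+C,\ \left(\frac{\gamma A^2}{2}+\beta A\right)z+\left(\frac{\gamma^2A}{2}+\gamma B\right)\bar z+\delta+D\right)$$ is called the centrally extended Heisenberg group.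
   Context: For $z\in\mathbb{C}\setminus\{0\}$, $a,a^\dagger,h,E$ are the generators (regarded as operators) of the four-dimensional $*$-Lie algebra $CEHeis$, the nontrivial central extension of the one-mode Heisenberg algebra, where $E$ is a nonzero self-adjoint central element, with commutation relations $[a,a^\dagger]=h$, $[h,a^\dagger]=zE$, $[a,h]=\bar zE$ (all omitted commutators being zero) and duality relations $a^*=a^\dagger$, $h^*=h$. The expressions $e^{u a^\dagger}$, $e^{vh}$, $e^{wa}$, $e^{yE}$ are exponentials of these operators, and the group operation on the family $g(u,v,w,y)$ is the product of operators. *)

theory Defs
  imports "HOL-Analysis.Inner_Product" "HOL-Algebra.Group"
begin

text \<open>
  Complex inner product spaces, conjugate-linear in the first argument. Norm and topology
  are those of the underlying real inner product. No completeness is required: a type of this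
  class serves as the common invariant domain of a family of unbounded operators, that is, as a
  dense subspace of its Hilbert space completion.
\<close>

class complex_inner = real_inner +
  fixes scaleC :: "complex \<Rightarrow> 'a \<Rightarrow> 'a" (infixr "*\<^sub>C" 75)
    and cinner :: "'a \<Rightarrow> 'a \<Rightarrow> complex"
  assumes scaleC_add_right: "c *\<^sub>C (x + y) = c *\<^sub>C x + c *\<^sub>C y"
    and scaleC_add_left: "(c + d) *\<^sub>C x = c *\<^sub>C x + d *\<^sub>C x"
    and scaleC_scaleC: "c *\<^sub>C d *\<^sub>C x = (c * d) *\<^sub>C x"
    and scaleC_of_real: "complex_of_real r *\<^sub>C x = r *\<^sub>R x"
    and cinner_commute: "cinner x y = cnj (cinner y x)"
    and cinner_add_left: "cinner (x + y) w = cinner x w + cinner y w"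
    and cinner_scaleC_left: "cinner (c *\<^sub>C x) y = cnj c * cinner x y"
    and Re_cinner: "Re (cinner x y) = inner x y"

lemma vector_space_scaleC: "vector_space (scaleC :: complex \<Rightarrow> 'a::complex_inner \<Rightarrow> 'a)"
proof
  fix x :: 'a
  show "1 *\<^sub>C x = x" using scaleC_of_real[of 1 x] by simp
qed (simp_all add: scaleC_add_right scaleC_add_left scaleC_scaleC)

instantiation complex :: complex_inner
begin

definition scaleC_complex :: "complex \<Rightarrow> complex \<Rightarrow> complex" where
  "scaleC_complex c x = c * x"

definition cinner_complex :: "complex \<Rightarrow> complex \<Rightarrow> complex" where
  "cinner_complex x y = cnj x * y"

instance
  by standard
    (simp_all add: scaleC_complex_def cinner_complex_def inner_complex_def algebra_simps
      scaleR_conv_of_real)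

end

definition op_scale :: "complex \<Rightarrow> ('a \<Rightarrow> 'a) \<Rightarrow> 'a \<Rightarrow> 'a::complex_inner" where
  "op_scale c T = (\<lambda>x. c *\<^sub>C T x)"

definition commutator :: "('a \<Rightarrow> 'a) \<Rightarrow> ('a \<Rightarrow> 'a) \<Rightarrow> 'a \<Rightarrow> 'a::complex_inner" where
  "commutator S T = (\<lambda>x. S (T x) - T (S x))"

definition is_adjoint :: "('a \<Rightarrow> 'a) \<Rightarrow> ('a \<Rightarrow> 'a::complex_inner) \<Rightarrow> bool" where
  "is_adjoint S T \<longleftrightarrow> (\<forall>x y. cinner (T x) y = cinner x (S y))"

text \<open>
  The exponential is the strong (pointwise, in norm) sum of the exponential series;
  it exists on the whole domain precisely for operators satisfying \<open>exponentiable\<close>.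
\<close>

definition exponentiable :: "('a \<Rightarrow> 'a::complex_inner) \<Rightarrow> bool" where
  "exponentiable T \<longleftrightarrow> (\<forall>x. summable (\<lambda>n. (1 / fact n) *\<^sub>R (T ^^ n) x))"

definition op_exp :: "('a \<Rightarrow> 'a) \<Rightarrow> 'a \<Rightarrow> 'a::complex_inner" where
  "op_exp T = (\<lambda>x. \<Sum>n. (1 / fact n) *\<^sub>R (T ^^ n) x)"

text \<open>
  Operator realisations of the centrally extended Heisenberg *-Lie algebra. The assumption that
  \<open>E\<close> is nonzero, together with the commutation relations and \<open>z \<noteq> 0\<close>, makes the four generators
  linearly independent. The operators \<open>a\<close> and \<open>h\<close> cannot both be bounded; an example, with
  real variable \<open>q\<close>, is \<open>h = q\<close>, \<open>E = 1\<close>,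
  \<open>a = cnj z * (d/dq + q^2 / (4 * (cmod z)^2))\<close> on the entire functions whose restriction to every
  horizontal strip of finite width is \<open>O(exp (- N * q^2))\<close> for all \<open>N\<close>, with the inner product
  of \<open>L^2\<close> on the real line.
\<close>

locale CEHeis =
  fixes z :: complex
    and a adag h E :: "'a::complex_inner \<Rightarrow> 'a"
  assumes linear_a: "Vector_Spaces.linear scaleC scaleC a"
    and linear_adag: "Vector_Spaces.linear scaleC scaleC adag"
    and linear_h: "Vector_Spaces.linear scaleC scaleC h"
    and linear_E: "Vector_Spaces.linear scaleC scaleC E"
    and E_nonzero: "E \<noteq> (\<lambda>x. 0)"
    and comm_a_adag: "commutator a adag = h"
    and comm_h_adag: "commutator h adag = op_scale z E"
    and comm_a_h: "commutator a h = op_scale (cnj z) E"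
    and comm_E_a: "commutator E a = (\<lambda>x. 0)"
    and comm_E_adag: "commutator E adag = (\<lambda>x. 0)"
    and comm_E_h: "commutator E h = (\<lambda>x. 0)"
    and adjoint_a: "is_adjoint adag a"
    and adjoint_h: "is_adjoint h h"
    and adjoint_E: "is_adjoint E E"
    and exp_adag: "\<And>u. exponentiable (op_scale u adag)"
    and exp_h: "\<And>v. exponentiable (op_scale v h)"
    and exp_a: "\<And>w. exponentiable (op_scale w a)"
    and exp_E: "\<And>y. exponentiable (op_scale y E)"

definition CE_g ::
  "('a \<Rightarrow> 'a) \<Rightarrow> ('a \<Rightarrow> 'a) \<Rightarrow> ('a \<Rightarrow> 'a) \<Rightarrow> ('a \<Rightarrow> 'a) \<Rightarrow>
    complex \<Rightarrow> complex \<Rightarrow> complex \<Rightarrow> complex \<Rightarrow> 'a \<Rightarrow> 'a::complex_inner" where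
  "CE_g a adag h E u v w y =
    op_exp (op_scale u adag) \<circ> op_exp (op_scale v h) \<circ> op_exp (op_scale w a) \<circ> op_exp (op_scale y E)"

definition CE_family ::
  "('a \<Rightarrow> 'a) \<Rightarrow> ('a \<Rightarrow> 'a) \<Rightarrow> ('a \<Rightarrow> 'a) \<Rightarrow> ('a \<Rightarrow> 'a) \<Rightarrow> ('a \<Rightarrow> 'a::complex_inner) set" where
  "CE_family a adag h E = {CE_g a adag h E u v w y | u v w y. True}"

definition CE_real_family ::
  "('a \<Rightarrow> 'a) \<Rightarrow> ('a \<Rightarrow> 'a) \<Rightarrow> ('a \<Rightarrow> 'a) \<Rightarrow> ('a \<Rightarrow> 'a) \<Rightarrow> ('a \<Rightarrow> 'a::complex_inner) set" where
  "CE_real_family a adag h E = {CE_g a adag h E u v w y | u v w y. u \<in> \<real> \<and> v \<in> \<real> \<and> w \<in> \<real>}"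

definition operator_monoid :: "('a \<Rightarrow> 'a) set \<Rightarrow> ('a \<Rightarrow> 'a) monoid" where
  "operator_monoid F = \<lparr>carrier = F, monoid.mult = (\<circ>), one = id\<rparr>"

fun CE_law ::
  "complex \<Rightarrow> real \<times> real \<times> real \<times> complex \<Rightarrow> real \<times> real \<times> real \<times> complex \<Rightarrow>
    real \<times> real \<times> real \<times> complex" where
  "CE_law z (\<alpha>, \<beta>, \<gamma>, \<delta>) (A, B, C, D) =
    (\<alpha> + A, \<beta> + B + \<gamma> * A, \<gamma> + C,
     of_real (\<gamma> * A\<^sup>2 / 2 + \<beta> * A) * z + of_real (\<gamma>\<^sup>2 * A / 2 + \<gamma> * B) * cnj z + \<delta> + D)"

definition CE_Heisenberg_group :: "complex \<Rightarrow> (real \<times> real \<times> real \<times> complex) monoid" where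
  "CE_Heisenberg_group z = \<lparr>carrier = UNIV, monoid.mult = CE_law z, one = (0, 0, 0, 0)\<rparr>"

end

(* All operators have adjoints on the common domain, so they and their exponentials are continuous
   for the weak topology given by the inner product, and operator identities may be tested on
   scalar functions t |-> <y, F(t) x>. Take F(t) to be either side of
   e^{wa} e^{t adag} e^{-q(t)E} = e^{t adag} e^{wth} e^{wa}, q(t) = w^2 t cnj z / 2 + w t^2 z / 2.
   Then <y, F(t) x> is an inner product of two strongly differentiable curves, hence entire, and
   both sides satisfy F'(t) = (adag + w h - t w z E) F(t) weakly, with the same value at 0. The
   equation determines all derivatives at 0 and thus F. The same argument handles the pairs (h, adag)
   and (a, h), and the group law follows by moving exponentials past each other. *)

theory Submission
  imports Defs "HOL-Complex_Analysis.Cauchy_Integral_Formula"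
begin

section \<open>Complex inner products, weak testing and adjoints\<close>

interpretation complex_vs: vector_space "scaleC :: complex \<Rightarrow> 'a::complex_inner \<Rightarrow> 'a"
  by (rule vector_space_scaleC)

lemma cinner_add_right: "cinner x (y + w) = cinner x y + cinner x w"
  by (metis cinner_add_left cinner_commute complex_cnj_add)

lemma cinner_scaleC_right: "cinner x (c *\<^sub>C y) = c * cinner x y"
  by (metis cinner_commute cinner_scaleC_left complex_cnj_cnj complex_cnj_mult)

lemma cinner_scaleR_left: "cinner (r *\<^sub>R x) y = r *\<^sub>R cinner x y"
  by (metis cinner_scaleC_left complex_cnj_complex_of_real scaleC_of_real scaleR_conv_of_real)

lemma cinner_scaleR_right: "cinner x (r *\<^sub>R y) = r *\<^sub>R cinner x y"
  by (metis cinner_scaleC_right scaleC_of_real scaleR_conv_of_real)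

lemma scaleR_scaleC: "r *\<^sub>R c *\<^sub>C x = (of_real r * c) *\<^sub>C x"
  by (metis scaleC_of_real scaleC_scaleC)

lemma norm_scaleC: "norm (c *\<^sub>C x) = cmod c * norm (x :: 'a::complex_inner)"
proof -
  have im: "Im (cinner x x) = 0"
    using cinner_commute[of x x] by (simp add: complex_eq_iff)
  have "(norm (c *\<^sub>C x))\<^sup>2 = Re (cnj c * c * cinner x x)"
    by (simp only: power2_norm_eq_inner Re_cinner[symmetric] cinner_scaleC_left
        cinner_scaleC_right mult.assoc
        mult.left_commute[of c])
  also have "cnj c * c = of_real ((cmod c)\<^sup>2)"
    by (simp add: complex_norm_square mult.commute del: of_real_power)
  also have "Re (of_real ((cmod c)\<^sup>2) * cinner x x) = (cmod c * norm x)\<^sup>2"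
    by (simp add: power_mult_distrib power2_norm_eq_inner Re_cinner del: of_real_power)
  finally show ?thesis
    by (simp add: power2_eq_iff_nonneg)
qed

text \<open>Real and imaginary parts are estimated separately by the real Cauchy-Schwarz inequality.
  The factor 2 is crude, but any constant gives the boundedness behind continuity and the product
  rule.\<close>

lemma cmod_cinner_le: "cmod (cinner x y) \<le> norm x * norm y * 2"
proof -
  have re: "\<bar>Re (cinner u v)\<bar> \<le> norm u * norm v" for u v :: 'a
    by (simp add: Re_cinner Cauchy_Schwarz_ineq2)
  have "Im (cinner x y) = Re (cinner (\<i> *\<^sub>C x) y)"
    by (simp add: cinner_scaleC_left)
  then have "\<bar>Im (cinner x y)\<bar> \<le> norm x * norm y"
    using re[of "\<i> *\<^sub>C x" y] by (simp add: norm_scaleC)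
  with re[of x y] cmod_le[of "cinner x y"] show ?thesis
    by linarith
qed

lemma bounded_bilinear_cinner: "bounded_bilinear cinner"
  by standard (auto simp: cinner_add_left cinner_add_right cinner_scaleR_left cinner_scaleR_right
      intro!: exI[of _ 2] cmod_cinner_le)

lemmas bounded_linear_cinner_right = bounded_bilinear.bounded_linear_right[OF bounded_bilinear_cinner]

lemma cinner_diff_right: "cinner x (y - w) = cinner x y - cinner x w"
  by (rule bounded_bilinear.diff_right[OF bounded_bilinear_cinner])

lemma cinner_minus_left: "cinner (- x) y = - cinner x y"
  by (rule bounded_bilinear.minus_left[OF bounded_bilinear_cinner])

text \<open>Vectors of the domain are separated by test vectors of the same domain, here
  \<open>u - v\<close> itself. This turns each operator identity below into an identity of scalar
  functions.\<close>

lemma cinner_eqI: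
  assumes "\<And>y. cinner y u = cinner y v"
  shows "u = v"
proof -
  have "cinner (u - v) (u - v) = 0"
    using assms by (simp add: cinner_diff_right)
  then show ?thesis
    using Re_cinner[of "u - v" "u - v"] by simp
qed

lemma is_adjointD: "is_adjoint S T \<Longrightarrow> cinner x (T y) = cinner (S x) y"
  unfolding is_adjoint_def by (metis cinner_commute)

lemma is_adjoint_sym: "is_adjoint S T \<Longrightarrow> is_adjoint T S"
  unfolding is_adjoint_def by (metis cinner_commute)

lemma is_adjoint_op_scale:
  "is_adjoint S T \<Longrightarrow> is_adjoint (op_scale (cnj c) S) (op_scale c T)"
  by (simp add: is_adjoint_def op_scale_def cinner_scaleC_left cinner_scaleC_right)

text \<open>Having an adjoint already forces homogeneity, since the scalar can be pulled out on the
  other side of the inner product.\<close>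

lemma adjoint_scaleC:
  assumes "is_adjoint S T"
  shows "T (c *\<^sub>C x) = c *\<^sub>C T x"
  by (rule cinner_eqI) (simp add: is_adjointD[OF assms] cinner_scaleC_right)

lemma adjoint_minus:
  assumes "is_adjoint S T"
  shows "T (- x) = - T x"
  using adjoint_scaleC[OF assms, of "- 1" x] by simp

section \<open>Exponential notation and uniqueness for a weak linear differential equation\<close>

abbreviation expo :: "('a \<Rightarrow> 'a) \<Rightarrow> complex \<Rightarrow> 'a \<Rightarrow> 'a::complex_inner" where
  "expo T t \<equiv> op_exp (op_scale t T)"

text \<open>The index \<open>y\<close> is a test vector; \<open>P\<close> and \<open>Q\<close> stand
  for the adjoints of the constant and the linear operator coefficient. Each differentiation at 0 is
  traded for a change of index, so strong induction over all indices at once kills every Taylor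
  coefficient of the entire function \<open>D y\<close>.\<close>

lemma weak_linear_ode_unique:
  fixes D :: "'b \<Rightarrow> complex \<Rightarrow> complex"
  assumes der: "\<And>y t. (D y has_field_derivative D (P y) t + t * D (Q y) t) (at t)"
    and init: "\<And>y. D y 0 = 0"
  shows "D y t = 0"
proof -
  have hol: "D y holomorphic_on UNIV" for y
    using der by (auto simp: holomorphic_on_def field_differentiable_def
        intro: has_field_derivative_at_within)
  have dd: "deriv (D y) = (\<lambda>t. D (P y) t + t * D (Q y) t)" for y
    using der by (auto intro!: DERIV_imp_deriv)
  have zero: "(deriv ^^ n) (D y) 0 = 0" for n y
  proof (induction n arbitrary: y rule: less_induct)
    case (less n)
    show ?case
    proof (cases n)
      case 0
      then show ?thesis by (simp add: init)
    next
      case (Suc m)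
      \<comment> \<open>Leibniz's rule leaves only derivatives of \<open>D (Q y)\<close> of order at
        most \<open>m < n\<close>, so the induction hypothesis removes every summand.\<close>
      have mult: "(deriv ^^ m) (\<lambda>t. t * D (Q y) t) 0 =
          (\<Sum>i = 0..m. of_nat (m choose i) * (deriv ^^ i) (\<lambda>t. t) 0 * (deriv ^^ (m - i)) (D (Q y)) 0)"
        using hol by (intro higher_deriv_mult[of "\<lambda>t. t" UNIV "D (Q y)" 0 m]) auto
      have "(deriv ^^ n) (D y) 0 = (deriv ^^ m) (\<lambda>t. D (P y) t + t * D (Q y) t) 0"
        by (simp add: Suc funpow_Suc_right dd del: funpow.simps)
      also have "\<dots> = (deriv ^^ m) (D (P y)) 0 + (deriv ^^ m) (\<lambda>t. t * D (Q y) t) 0"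
        by (rule higher_deriv_add[OF hol holomorphic_on_mult[OF holomorphic_on_ident hol]
              open_UNIV UNIV_I])
      finally show ?thesis
        unfolding mult by (simp add: less.IH Suc del: higher_deriv_ident)
    qed
  qed
  show ?thesis
    by (rule holomorphic_fun_eq_0_on_connected[OF hol[of y] open_UNIV connected_UNIV, of 0])
      (auto simp: zero)
qed

section \<open>One-parameter groups generated by an operator with an adjoint\<close>

locale entire_pair =
  fixes T S :: "'a::complex_inner \<Rightarrow> 'a"
  assumes adj: "is_adjoint S T"
    and exponentiable: "\<And>u. exponentiable (op_scale u T)"
    and exponentiable_adj: "\<And>u. exponentiable (op_scale u S)"
begin

lemma funpow_op_scale: "(op_scale t T ^^ n) x = t ^ n *\<^sub>C (T ^^ n) x"
  by (induction n) (simp_all add: op_scale_def adjoint_scaleC[OF adj] scaleC_scaleC)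

lemma expo_sums: "(\<lambda>n. (t ^ n / fact n) *\<^sub>C (T ^^ n) x) sums expo T t x"
proof -
  have "(\<lambda>n. (1 / fact n) *\<^sub>R (op_scale t T ^^ n) x) sums expo T t x"
    using exponentiable unfolding exponentiable_def op_exp_def by (blast intro: summable_sums)
  then show ?thesis
    by (simp add: funpow_op_scale scaleR_scaleC)
qed

lemma cinner_expo_sums:
  "(\<lambda>n. cinner y ((T ^^ n) x) / fact n * t ^ n) sums cinner y (expo T t x)"
  using bounded_linear.sums[OF bounded_linear_cinner_right expo_sums[of t x], of y]
  by (simp add: cinner_scaleC_right mult.commute)

lemma expo_0: "expo T 0 x = x"
proof (rule cinner_eqI)
  fix y
  have "(\<lambda>n. cinner y ((T ^^ n) x) / fact n * 0 ^ n) sums cinner y x"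
    using powser_sums_zero[of "\<lambda>n. cinner y ((T ^^ n) x) / fact n"] by simp
  then show "cinner y (expo T 0 x) = cinner y x"
    by (rule sums_unique2[OF cinner_expo_sums])
qed

text \<open>Convergence at a parameter larger than 1 bounds the terms there, which gives geometric
  decay at parameter 1. Absolute convergence thus follows from mere convergence.\<close>

lemma summable_norm_funpow: "summable (\<lambda>n. norm ((T ^^ n) x) / fact n)"
proof -
  \<comment> \<open>The series is taken at \<open>t = 2\<close>, whence the ratio
    \<open>1 / 2\<close> below.\<close>
  have "(\<lambda>n. (2 ^ n / fact n) *\<^sub>C (T ^^ n) x) \<longlonglongrightarrow> 0"
    using expo_sums by (rule sums_summable[THEN summable_LIMSEQ_zero])
  then have "Bseq (\<lambda>n. (2 ^ n / fact n) *\<^sub>C (T ^^ n) x)"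
    by (rule convergentI[THEN convergent_imp_Bseq])
  then obtain M where M: "\<And>n. norm ((2 ^ n / fact n) *\<^sub>C (T ^^ n) x) \<le> M"
    unfolding Bseq_def by blast
  have "norm ((T ^^ n) x) / fact n \<le> M * (1 / 2) ^ n" for n
    using M[of n] by (simp add: norm_scaleC norm_divide norm_power power_divide field_simps)
  then show ?thesis
    using summable_comparison_test'[OF summable_mult[OF summable_geometric[of "1 / 2 :: real"]],
        of 0 "\<lambda>n. norm ((T ^^ n) x) / fact n" M]
    by simp
qed

text \<open>An everywhere convergent scalar power series may be differentiated termwise. The index
  shift produces one more factor \<open>T\<close>, which the adjoint moves onto
  \<open>y\<close>.\<close>

lemma cinner_expo_has_derivative:
  "((\<lambda>t. cinner y (expo T t x)) has_field_derivative cinner (S y) (expo T t x)) (at t)"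
proof -
  define c where "c n = cinner y ((T ^^ n) x) / fact n" for n
  have sums: "(\<lambda>n. c n * t ^ n) sums cinner y (expo T t x)" for t
    unfolding c_def by (rule cinner_expo_sums)
  have "diffs c = (\<lambda>n. cinner (S y) ((T ^^ n) x) / fact n)"
    by (auto simp: diffs_def c_def fun_eq_iff is_adjointD[OF adj] simp del: of_nat_Suc)
  then have d: "(\<Sum>n. diffs c n * t ^ n) = cinner (S y) (expo T t x)"
    using cinner_expo_sums[of "S y" x t] by (simp add: sums_iff)
  have "((\<lambda>t. \<Sum>n. c n * t ^ n) has_field_derivative (\<Sum>n. diffs c n * t ^ n)) (at t)"
    by (rule termdiffs_strong_converges_everywhere) (rule sums_summable[OF sums])
  then show ?thesis
    using sums by (simp add: d sums_iff)
qed

text \<open>The Taylor expansion of \<open>t \<mapsto> cinner y (expo T t x)\<close> around \<open>t\<close> is the weak form of the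
  exponential series at \<open>expo T t x\<close>.\<close>

lemma expo_add: "expo T s (expo T t x) = expo T (s + t) x"
proof (rule cinner_eqI)
  fix y
  define f where "f y t = cinner y (expo T t x)" for y t
  have d: "deriv (f y) = f (S y)" for y
    unfolding f_def using cinner_expo_has_derivative by (auto intro!: DERIV_imp_deriv)
  have hd: "(deriv ^^ n) (f y) = f ((S ^^ n) y)" for n y
    by (induction n) (simp_all add: d)
  have adjn: "cinner y ((T ^^ n) u) = cinner ((S ^^ n) y) u" for n u y
    by (induction n arbitrary: y) (simp_all add: is_adjointD[OF adj] funpow_swap1[of S])
  have "f y holomorphic_on ball t (cmod s + 1)"
    unfolding holomorphic_on_def field_differentiable_def f_def
    by (intro ballI exI) (rule has_field_derivative_at_within[OF cinner_expo_has_derivative])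
  then have "(\<lambda>n. (deriv ^^ n) (f y) t / fact n * ((s + t) - t) ^ n) sums f y (s + t)"
    by (rule holomorphic_power_series) (simp add: dist_norm)
  then have "(\<lambda>n. cinner y ((T ^^ n) (expo T t x)) / fact n * s ^ n) sums f y (s + t)"
    by (simp add: hd adjn f_def)
  from sums_unique2[OF cinner_expo_sums this]
  show "cinner y (expo T s (expo T t x)) = cinner y (expo T (s + t) x)"
    by (simp add: f_def)
qed

text \<open>The adjoint \<open>P'\<close> carries \<open>P\<close> through the series weakly, in
  place of norm continuity of \<open>P\<close>.\<close>

lemma expo_commute:
  assumes "is_adjoint P' P" and "\<And>x. P (T x) = T (P x)"
  shows "P (expo T t x) = expo T t (P x)"
proof (rule cinner_eqI)
  fix y
  have pow: "P ((T ^^ n) x) = (T ^^ n) (P x)" for n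
    by (induction n) (simp_all add: assms(2))
  have "(\<lambda>n. cinner (P' y) ((T ^^ n) x) / fact n * t ^ n) sums cinner (P' y) (expo T t x)"
    by (rule cinner_expo_sums)
  then have "(\<lambda>n. cinner y ((T ^^ n) (P x)) / fact n * t ^ n) sums cinner y (P (expo T t x))"
    by (simp add: is_adjointD[OF assms(1), symmetric] pow)
  then show "cinner y (P (expo T t x)) = cinner y (expo T t (P x))"
    by (rule sums_unique2[OF _ cinner_expo_sums])
qed

lemma expo_T_commute: "T (expo T t x) = expo T t (T x)"
  by (rule expo_commute[OF adj]) simp

text \<open>Absolute convergence bounds the tail of the series from order 2 on by a constant times
  \<open>(cmod k)\<^sup>2\<close>. A derivative in norm, not only a weak one, is what the product
  rule for \<open>cinner\<close> requires of each of its two curves.\<close>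

lemma expo_has_derivative_0: "((\<lambda>t. expo T t x) has_derivative (\<lambda>k. k *\<^sub>C T x)) (at 0)"
proof -
  \<comment> \<open>The shift by 2 drops the constant and the linear term, which are
    \<open>x\<close> and \<open>k *\<^sub>C T x\<close>.\<close>
  define b where "b n = norm ((T ^^ (n + 2)) x) / fact (n + 2)" for n
  have sb: "summable b"
    unfolding b_def using summable_norm_funpow by (rule summable_ignore_initial_segment)
  define C where "C = suminf b"
  have est: "norm (expo T k x - x - k *\<^sub>C T x) \<le> C * (cmod k)\<^sup>2" if "cmod k \<le> 1" for k
  proof -
    let ?g = "\<lambda>n. (k ^ (n + 2) / fact (n + 2)) *\<^sub>C (T ^^ (n + 2)) x"
    have "?g sums (expo T k x - (\<Sum>n<2. (k ^ n / fact n) *\<^sub>C (T ^^ n) x))"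
      using expo_sums by (rule sums_split_initial_segment)
    then have g: "?g sums (expo T k x - x - k *\<^sub>C T x)"
      by (simp add: numeral_2_eq_2 algebra_simps)
    have n: "norm (?g n) \<le> (cmod k)\<^sup>2 * b n" for n
    proof -
      have "cmod k ^ n * (cmod k)\<^sup>2 \<le> 1 * (cmod k)\<^sup>2"
        using that by (intro mult_right_mono power_le_one) auto
      then have "cmod k ^ n * (cmod k)\<^sup>2 * b n \<le> (cmod k)\<^sup>2 * b n"
        by (intro mult_right_mono) (auto simp: b_def)
      then show ?thesis
        by (simp add: norm_scaleC norm_divide norm_power b_def power_add norm_mult
            power2_eq_square mult_ac del: fact_Suc funpow.simps)
    qed
    have "norm (\<Sum>i<n. ?g i) \<le> C * (cmod k)\<^sup>2" for n
    proof -
      have "norm (\<Sum>i<n. ?g i) \<le> (\<Sum>i<n. (cmod k)\<^sup>2 * b i)"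
        by (rule sum_norm_le) (rule n)
      also have "\<dots> = (cmod k)\<^sup>2 * (\<Sum>i<n. b i)"
        by (simp add: sum_distrib_left)
      also have "\<dots> \<le> (cmod k)\<^sup>2 * C"
        unfolding C_def by (intro mult_left_mono sum_le_suminf sb) (auto simp: b_def)
      finally show ?thesis
        by (simp add: mult.commute)
    qed
    then show ?thesis
      using LIMSEQ_le_const2[OF tendsto_norm[OF g[unfolded sums_def]]] by blast
  qed
  have "((\<lambda>k. C * cmod k) \<longlongrightarrow> C * cmod 0) (at 0)"
    by (intro tendsto_intros)
  moreover have "\<forall>\<^sub>F k in at 0. norm (norm (expo T (0 + k) x - expo T 0 x - k *\<^sub>C T x) / norm k)
      \<le> C * cmod k"
    unfolding eventually_at
  proof (intro exI[of _ 1] conjI ballI impI)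
    fix k :: complex
    assume k: "k \<noteq> 0 \<and> dist k 0 < 1"
    then show "norm (norm (expo T (0 + k) x - expo T 0 x - k *\<^sub>C T x) / norm k) \<le> C * cmod k"
      using est[of k] by (simp add: expo_0 divide_le_eq power2_eq_square mult.assoc)
  qed simp
  ultimately have "(\<lambda>k. norm (expo T (0 + k) x - expo T 0 x - k *\<^sub>C T x) / norm k) \<midarrow>0\<rightarrow> 0"
    by (simp add: Lim_null_comparison)
  moreover have "bounded_linear (\<lambda>k. k *\<^sub>C T x)"
    by (rule bounded_linear_intro[of _ "norm (T x)"])
      (simp_all add: scaleC_add_left scaleR_scaleC norm_scaleC scaleR_conv_of_real)
  ultimately show ?thesis
    unfolding has_derivative_at by blast
qed

text \<open>The group law \<open>expo_add\<close> translates the derivative at 0 to any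
  \<open>t\<close>.\<close>

lemma expo_has_derivative:
  "((\<lambda>t. expo T t x) has_derivative (\<lambda>k. k *\<^sub>C T (expo T t x))) (at t)"
proof -
  have "((\<lambda>s. expo T (s - t) (expo T t x)) has_derivative (\<lambda>k. k *\<^sub>C T (expo T t x))) (at t)"
  proof (rule has_derivative_compose[of "\<lambda>s. s - t" "\<lambda>k. k"])
    show "((\<lambda>s. s - t) has_derivative (\<lambda>k. k)) (at t)"
      by (auto intro!: derivative_eq_intros)
    show "((\<lambda>s. expo T s (expo T t x)) has_derivative (\<lambda>k. k *\<^sub>C T (expo T t x))) (at (t - t))"
      using expo_has_derivative_0[of "expo T t x"] by simp
  qed
  then show ?thesis
    by (simp add: expo_add)
qed

lemma entire_pair_adjoint: "entire_pair S T"
  by (simp add: entire_pair_def is_adjoint_sym[OF adj] exponentiable exponentiable_adj)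

lemma entire_pair_op_scale: "entire_pair (op_scale c T) (op_scale (cnj c) S)"
proof -
  have "op_scale u (op_scale v R) = op_scale (u * v) R" for u v and R :: "'a \<Rightarrow> 'a"
    by (simp add: op_scale_def scaleC_scaleC)
  then show ?thesis
    by (simp add: entire_pair_def is_adjoint_op_scale adj exponentiable exponentiable_adj)
qed

text \<open>Conjugating the weak series of \<open>T\<close> term by term gives that of
  \<open>S\<close> at \<open>cnj t\<close>. Exponentials therefore have adjoints again and can
  themselves be moved across the inner product or fed to \<open>expo_commute\<close>.\<close>

lemma is_adjoint_expo: "is_adjoint (expo S (cnj t)) (expo T t)"
proof -
  interpret S: entire_pair S T
    by (rule entire_pair_adjoint)
  have adjn: "cinner ((T ^^ n) x) y = cinner x ((S ^^ n) y)" for n x y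
    by (induction n arbitrary: y)
      (simp_all add: adj[unfolded is_adjoint_def, rule_format] funpow_swap1[of S])
  have "cinner (expo T t x) y = cinner x (expo S (cnj t) y)" for x y
  proof (rule sums_unique2)
    show "(\<lambda>n. cinner x ((S ^^ n) y) / fact n * cnj t ^ n) sums cinner x (expo S (cnj t) y)"
      by (rule S.cinner_expo_sums)
    have "(\<lambda>n. cnj (cinner y ((T ^^ n) x) / fact n * t ^ n)) sums cnj (cinner y (expo T t x))"
      using cinner_expo_sums by (simp only: sums_cnj)
    then show "(\<lambda>n. cinner x ((S ^^ n) y) / fact n * cnj t ^ n) sums cinner (expo T t x) y"
      by (simp add: cinner_commute[of y, symmetric] adjn flip: cinner_commute[of _ y])
  qed
  then show ?thesis
    by (simp add: is_adjoint_def)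
qed

text \<open>This is the expansion of \<open>exp (w T) Y exp (- w T)\<close> in iterated commutators:
  they are \<open>H\<close>, then \<open>\<xi>\<close> times \<open>E\<close>, then zero, so it
  stops at the quadratic term. Both sides solve \<open>F' = T F\<close> weakly with initial value
  \<open>Y x\<close>.\<close>

lemma expo_conjugation:
  assumes "is_adjoint Y' Y" "is_adjoint H' H" "is_adjoint E' E"
    and TY: "\<And>x. T (Y x) = Y (T x) + H x"
    and TH: "\<And>x. T (H x) = H (T x) + \<xi> *\<^sub>C E x"
    and TE: "\<And>x. T (E x) = E (T x)"
  shows "expo T w (Y x) =
    Y (expo T w x) + w *\<^sub>C H (expo T w x) + (w\<^sup>2 * \<xi> / 2) *\<^sub>C E (expo T w x)"
proof (rule cinner_eqI)
  fix y
  define D where "D y = (\<lambda>w. cinner y (expo T w (Y x)) - (cinner y (Y (expo T w x)) +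
    w * cinner y (H (expo T w x)) + w\<^sup>2 * \<xi> / 2 * cinner y (E (expo T w x))))" for y
  have der: "((\<lambda>w. cinner y (R (expo T w x))) has_field_derivative
      cinner y (R (T (expo T w x)))) (at w)" if "is_adjoint R' R" for R R' y w
    using cinner_expo_has_derivative[of "R' y" x w]
    by (simp add: is_adjointD[OF that] is_adjointD[OF adj])
  have "D y w = 0"
  \<comment> \<open>The equation has a constant coefficient, so the linear one is encoded by the
    zero test vector, for which \<open>D\<close> vanishes.\<close>
  proof (rule weak_linear_ode_unique[of D S "\<lambda>y. 0"])
    fix y t
    have zero: "D 0 t = 0"
      by (simp add: D_def bounded_bilinear.zero_left[OF bounded_bilinear_cinner])
    show "(D y has_field_derivative D (S y) t + t * D 0 t) (at t)"
      unfolding zero unfolding D_def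
    proof (rule DERIV_cong)
      have p: "((\<lambda>w. w\<^sup>2 * \<xi> / 2) has_field_derivative t * \<xi>) (at t)"
        by (auto intro!: derivative_eq_intros)
      show "((\<lambda>w. cinner y (expo T w (Y x)) - (cinner y (Y (expo T w x)) +
          w * cinner y (H (expo T w x)) + w\<^sup>2 * \<xi> / 2 * cinner y (E (expo T w x))))
        has_field_derivative cinner (S y) (expo T t (Y x)) - (cinner y (Y (T (expo T t x))) +
          (1 * cinner y (H (expo T t x)) + cinner y (H (T (expo T t x))) * t) +
          (t * \<xi> * cinner y (E (expo T t x)) +
            cinner y (E (T (expo T t x))) * (t\<^sup>2 * \<xi> / 2)))) (at t)"
        by (intro DERIV_diff DERIV_add DERIV_mult p DERIV_ident cinner_expo_has_derivative
            der[OF assms(1)] der[OF assms(2)] der[OF assms(3)])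
    qed (simp add: is_adjointD[OF adj, symmetric] TY TH TE cinner_add_right cinner_scaleC_right
        power2_eq_square algebra_simps)
  qed (simp add: D_def expo_0)
  then show "cinner y (expo T w (Y x)) = cinner y
      (Y (expo T w x) + w *\<^sub>C H (expo T w x) + (w\<^sup>2 * \<xi> / 2) *\<^sub>C E (expo T w x))"
    by (simp add: D_def cinner_add_right cinner_scaleC_right)
qed

end

section \<open>Exchanging two exponentials\<close>

text \<open>Moving the first exponential to the other side of the inner product leaves a strongly
  differentiable curve in each argument, so no joint summability of the double series is needed.\<close>

lemma cinner_expo_expo_has_derivative:
  assumes "entire_pair T S" "entire_pair U V"
    and r: "(r has_field_derivative r') (at t)"
  shows "((\<lambda>t. cinner y (expo T t (expo U (r t) x))) has_field_derivative
    cinner y (T (expo T t (expo U (r t) x))) + r' * cinner y (expo T t (U (expo U (r t) x)))) (at t)"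
proof -
  interpret T: entire_pair T S by fact
  interpret S: entire_pair S T by (rule T.entire_pair_adjoint)
  interpret U: entire_pair U V by fact
  have S': "((\<lambda>t. expo S (cnj t) y) has_derivative (\<lambda>k. cnj k *\<^sub>C S (expo S (cnj t) y))) (at t)"
    by (rule has_derivative_compose[OF bounded_linear.has_derivative[OF bounded_linear_cnj
            has_derivative_ident] S.expo_has_derivative])
  have U': "((\<lambda>t. expo U (r t) x) has_derivative (\<lambda>k. (r' * k) *\<^sub>C U (expo U (r t) x))) (at t)"
    by (rule has_derivative_compose[OF r[unfolded has_field_derivative_def] U.expo_has_derivative])
  have move: "cinner (expo S (cnj t) u) v = cinner u (expo T t v)" for t u v
    by (rule is_adjointD[OF T.is_adjoint_expo, symmetric])
  show ?thesis
    unfolding has_field_derivative_def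
    by (rule has_derivative_eq_rhs[OF bounded_bilinear.FDERIV[OF bounded_bilinear_cinner S' U',
            unfolded move]])
      (simp add: fun_eq_iff move cinner_scaleC_left cinner_scaleC_right S.expo_T_commute T.expo_T_commute
        T.is_adjoint_expo[THEN adjoint_scaleC]
        is_adjointD[OF T.adj, symmetric] algebra_simps)
qed

text \<open>The constants \<open>\<xi>\<close> and \<open>\<zeta>\<close> are kept general so that
  one exchange lemma serves all pairs of generators: for \<open>a\<close> and \<open>adag\<close>
  both matter, while for the other two pairs \<open>H\<close> is a multiple of the central element
  and both constants are 0.\<close>

locale central_commutators =
  X: entire_pair X X' + Y: entire_pair Y Y' + H: entire_pair H H' + E: entire_pair E E'
  for X X' Y Y' H H' E E' :: "'a::complex_inner \<Rightarrow> 'a" +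
  fixes \<xi> \<zeta> :: complex
  assumes XY: "X (Y x) = Y (X x) + H x"
    and XH: "X (H x) = H (X x) + \<xi> *\<^sub>C E x"
    and HY: "H (Y x) = Y (H x) + \<zeta> *\<^sub>C E x"
    and EX: "E (X x) = X (E x)"
    and EY: "E (Y x) = Y (E x)"
    and EH: "E (H x) = H (E x)"
begin

lemma expo_X_Y: "expo X w (Y x) =
    Y (expo X w x) + w *\<^sub>C H (expo X w x) + (w\<^sup>2 * \<xi> / 2) *\<^sub>C E (expo X w x)"
  by (rule X.expo_conjugation[OF Y.adj H.adj E.adj XY XH EX[symmetric]])

lemma expo_Y_H: "expo Y t (H x) = H (expo Y t x) - (t * \<zeta>) *\<^sub>C E (expo Y t x)"
proof -
  \<comment> \<open>In \<open>expo_conjugation\<close>, \<open>Y\<close> now conjugates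
    \<open>H\<close>. Their commutator in this order is \<open>- \<zeta>\<close> times
    \<open>E\<close>, which commutes with \<open>Y\<close>, so the quadratic coefficient is
    0.\<close>
  have "expo Y t (H x) = H (expo Y t x) + t *\<^sub>C op_scale (- \<zeta>) E (expo Y t x) +
      (t\<^sup>2 * 0 / 2) *\<^sub>C E (expo Y t x)"
    by (rule Y.expo_conjugation[OF H.adj is_adjoint_op_scale[OF E.adj] E.adj])
      (simp_all add: HY op_scale_def EY Y.adj[THEN adjoint_scaleC]
        Y.adj[THEN adjoint_minus])
  then show ?thesis
    by (simp add: op_scale_def scaleC_scaleC)
qed

lemma expo_swap:
  "expo X w (expo Y t x) =
    expo Y t (expo H (w * t) (expo X w (expo E (w\<^sup>2 * t * \<xi> / 2 + w * t\<^sup>2 * \<zeta> / 2) x)))"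
proof -
  \<comment> \<open>The derivative of \<open>q\<close> is
    \<open>w\<^sup>2 * \<xi> / 2 + w * t * \<zeta>\<close>: the first term cancels the quadratic
    term of \<open>expo_X_Y\<close>, the second reproduces the one coming from
    \<open>expo_Y_H\<close>. Hence both sides obey the same equation.\<close>
  define q where "q t = w\<^sup>2 * t * \<xi> / 2 + w * t\<^sup>2 * \<zeta> / 2" for t
  have E_expo_Y: "E (expo Y t x) = expo Y t (E x)" for t x
    by (rule Y.expo_commute[OF E.adj EY])
  have E_expo_X: "E (expo X t x) = expo X t (E x)" for t x
    by (rule X.expo_commute[OF E.adj EX])
  have "expo X w (expo Y t (expo E (- q t) x)) = expo Y t (expo H (w * t) (expo X w x))" for x t
  proof (rule cinner_eqI)
    fix y
    define f where "f y = (\<lambda>t. cinner y (expo X w (expo Y t (expo E (- q t) x))))" for y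
    define g where "g y = (\<lambda>t. cinner y (expo Y t (expo H (w * t) (expo X w x))))" for y
    define D where "D y = (\<lambda>t. f y t - g y t)" for y
    \<comment> \<open>These are the adjoints, applied to \<open>y\<close>, of the coefficients
      \<open>Y + w H\<close> and \<open>- w \<zeta> E\<close>.\<close>
    let ?P = "\<lambda>y. Y' y + cnj w *\<^sub>C H' y" and ?Q = "\<lambda>y. cnj (- w * \<zeta>) *\<^sub>C E' y"
    note move = is_adjointD[OF Y.adj, symmetric] is_adjointD[OF H.adj, symmetric]
      is_adjointD[OF E.adj, symmetric]
    \<comment> \<open>The outer exponential of \<open>X\<close> does not depend on \<open>t\<close>.
      It is moved to the test vector, so that the derivative rule for two exponentials applies, and
      then brought back past \<open>Y\<close> by \<open>expo_X_Y\<close>.\<close>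
    have f': "(f y has_field_derivative f (?P y) t + t * f (?Q y) t) (at t)" for y t
    proof -
      have q': "((\<lambda>t. - q t) has_field_derivative - (w\<^sup>2 * \<xi> / 2 + w * t * \<zeta>)) (at t)"
        unfolding q_def by (auto intro!: derivative_eq_intros simp: power2_eq_square)
      show ?thesis
        using cinner_expo_expo_has_derivative[OF Y.entire_pair_axioms E.entire_pair_axioms q',
            of "expo X' (cnj w) y" x]
        by (simp add: f_def is_adjointD[OF X.is_adjoint_expo, symmetric] expo_X_Y
            cinner_add_left cinner_add_right cinner_minus_left cinner_scaleC_left
            cinner_scaleC_right move
            flip: E_expo_Y E_expo_X)
          (simp add: algebra_simps)
    qed
    have g': "(g y has_field_derivative g (?P y) t + t * g (?Q y) t) (at t)" for y t
    proof -
      have wt: "((\<lambda>t. w * t) has_field_derivative w) (at t)"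
        by (auto intro!: derivative_eq_intros)
      show ?thesis
        using cinner_expo_expo_has_derivative[OF Y.entire_pair_axioms H.entire_pair_axioms wt,
            of y "expo X w x"]
        by (simp add: g_def expo_Y_H cinner_diff_right
            cinner_add_left cinner_minus_left cinner_scaleC_left cinner_scaleC_right move)
          (simp add: algebra_simps)
    qed
    have "D y t = 0"
    proof (rule weak_linear_ode_unique[of D ?P ?Q])
      show "(D y has_field_derivative D (?P y) t + t * D (?Q y) t) (at t)" for y t
        unfolding D_def using DERIV_diff[OF f'[of y t] g'[of y t]] by (simp add: algebra_simps)
      show "D y 0 = 0" for y
        by (simp add: D_def f_def g_def q_def X.expo_0 Y.expo_0 H.expo_0 E.expo_0)
    qed
    then show "cinner y (expo X w (expo Y t (expo E (- q t) x))) =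
        cinner y (expo Y t (expo H (w * t) (expo X w x)))"
      by (simp add: D_def f_def g_def)
  qed
  \<comment> \<open>Starting from \<open>expo E (q t) x\<close> cancels the central factor on the
    left and creates it on the right.\<close>
  from this[of t "expo E (q t) x"] show ?thesis
    by (simp add: E.expo_add E.expo_0 flip: q_def)
qed

end

section \<open>Exchange relations for the four generators\<close>

context CEHeis
begin

lemma commutation_relations:
  shows "a (adag x) = adag (a x) + h x"
    and "h (adag x) = adag (h x) + z *\<^sub>C E x"
    and "a (h x) = h (a x) + cnj z *\<^sub>C E x"
    and "E (a x) = a (E x)" and "E (adag x) = adag (E x)" and "E (h x) = h (E x)"
  using fun_cong[OF comm_a_adag, of x] fun_cong[OF comm_h_adag, of x] fun_cong[OF comm_a_h, of x]
    fun_cong[OF comm_E_a, of x] fun_cong[OF comm_E_adag, of x] fun_cong[OF comm_E_h, of x]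
  by (auto simp: commutator_def op_scale_def algebra_simps)

sublocale a: entire_pair a adag
  by (intro entire_pair.intro adjoint_a exp_a exp_adag)

sublocale adag: entire_pair adag a
  by (rule a.entire_pair_adjoint)

sublocale h: entire_pair h h
  by (intro entire_pair.intro adjoint_h exp_h)

sublocale E: entire_pair E E
  by (intro entire_pair.intro adjoint_E exp_E)

lemma expo_op_scale_E: "expo (op_scale c E) t = expo E (t * c)"
  by (simp add: op_scale_def scaleC_scaleC)

text \<open>\<open>expo_commute\<close> is used twice: first a generator passes through
  \<open>expo E r\<close>, then \<open>expo E r\<close>, which has an adjoint, passes through the
  exponential of that generator. As rewrite rules these push central factors innermost.\<close>

lemma expo_E_commute:
  "expo E r (expo adag u x) = expo adag u (expo E r x)"
  "expo E r (expo h u x) = expo h u (expo E r x)"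
  "expo E r (expo a u x) = expo a u (expo E r x)"
  by (auto intro!: adag.expo_commute[OF E.is_adjoint_expo] h.expo_commute[OF E.is_adjoint_expo]
      a.expo_commute[OF E.is_adjoint_expo]
      E.expo_commute[OF adag.adj, symmetric] E.expo_commute[OF h.adj, symmetric]
      E.expo_commute[OF a.adj, symmetric] simp: commutation_relations)

lemma expo_a_adag:
  "expo a w (expo adag u x) =
    expo adag u (expo h (w * u) (expo a w (expo E (w\<^sup>2 * u * cnj z / 2 + w * u\<^sup>2 * z / 2) x)))"
proof -
  interpret central_commutators a adag adag a h h E E "cnj z" z
    by unfold_locales (rule commutation_relations)+
  show ?thesis
    by (rule expo_swap)
qed

text \<open>The commutator \<open>z E\<close> plays the role of \<open>H\<close> in
  \<open>expo_swap\<close>, whose middle exponential is then itself the central correction.\<close>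

lemma expo_h_adag: "expo h v (expo adag u x) = expo adag u (expo h v (expo E (v * u * z) x))"
proof -
  interpret zE: entire_pair "op_scale z E" "op_scale (cnj z) E"
    by (rule E.entire_pair_op_scale)
  interpret central_commutators h h adag a "op_scale z E" "op_scale (cnj z) E" E E 0 0
    by unfold_locales
      (simp_all add: commutation_relations op_scale_def h.adj[THEN adjoint_scaleC]
        adag.adj[THEN adjoint_scaleC] E.adj[THEN adjoint_scaleC])
  show ?thesis
    using expo_swap[of v u x] by (simp add: expo_op_scale_E expo_E_commute E.expo_0)
qed

lemma expo_a_h: "expo a w (expo h v x) = expo h v (expo a w (expo E (w * v * cnj z) x))"
proof -
  interpret zE: entire_pair "op_scale (cnj z) E" "op_scale (cnj (cnj z)) E"
    by (rule E.entire_pair_op_scale)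
  interpret central_commutators a adag h h "op_scale (cnj z) E" "op_scale (cnj (cnj z)) E" E E 0 0
    by unfold_locales
      (simp_all add: commutation_relations op_scale_def h.adj[THEN adjoint_scaleC]
        a.adj[THEN adjoint_scaleC] E.adj[THEN adjoint_scaleC])
  show ?thesis
    using expo_swap[of w v x] by (simp add: expo_op_scale_E expo_E_commute E.expo_0)
qed

section \<open>The group law and the resulting groups\<close>

abbreviation g where "g \<equiv> CE_g a adag h E"

lemma g_apply: "g u v w y x = expo adag u (expo h v (expo a w (expo E y x)))"
  by (simp add: CE_g_def)

lemma g_mult:
  "g \<alpha> \<beta> \<gamma> \<delta> \<circ> g A B C D = g (\<alpha> + A) (\<beta> + B + \<gamma> * A) (\<gamma> + C)
    ((\<gamma> * A\<^sup>2 / 2 + \<beta> * A) * z + (\<gamma>\<^sup>2 * A / 2 + \<gamma> * B) * cnj z + \<delta> + D)"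
proof
  fix x
  have "(g \<alpha> \<beta> \<gamma> \<delta> \<circ> g A B C D) x =
      expo adag \<alpha> (expo h \<beta> (expo a \<gamma> (expo adag A (expo h B (expo a C (expo E (\<delta> + D) x))))))"
    by (simp add: g_apply expo_E_commute E.expo_add)
  \<comment> \<open>\<open>expo a \<gamma>\<close> moves right, first past
    \<open>expo adag A\<close>, which creates the factor \<open>expo h (\<gamma> * A)\<close>, then
    past \<open>expo h B\<close>.\<close>
  also have "\<dots> = expo adag \<alpha> (expo h \<beta> (expo adag A (expo h (\<gamma> * A) (expo h B (expo a \<gamma> (expo a C
      (expo E (\<gamma> * B * cnj z + (\<gamma>\<^sup>2 * A * cnj z / 2 + \<gamma> * A\<^sup>2 * z / 2) + (\<delta> + D)) x)))))))"
    by (simp add: expo_a_adag expo_E_commute expo_a_h E.expo_add add.assoc)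
  \<comment> \<open>Now \<open>expo h \<beta>\<close> passes \<open>expo adag A\<close>, and
    neighbouring exponentials of the same generator merge.\<close>
  also have "\<dots> = expo adag (\<alpha> + A) (expo h (\<beta> + (\<gamma> * A + B)) (expo a (\<gamma> + C) (expo E
      (\<beta> * A * z + (\<gamma> * B * cnj z + (\<gamma>\<^sup>2 * A * cnj z / 2 + \<gamma> * A\<^sup>2 * z / 2) + (\<delta> + D))) x)))"
    by (simp add: expo_h_adag expo_E_commute E.expo_add adag.expo_add h.expo_add a.expo_add)
  also have "\<dots> = g (\<alpha> + A) (\<beta> + B + \<gamma> * A) (\<gamma> + C)
      ((\<gamma> * A\<^sup>2 / 2 + \<beta> * A) * z + (\<gamma>\<^sup>2 * A / 2 + \<gamma> * B) * cnj z + \<delta> + D) x"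
    by (simp add: g_apply algebra_simps)
  finally show "(g \<alpha> \<beta> \<gamma> \<delta> \<circ> g A B C D) x = g (\<alpha> + A) (\<beta> + B + \<gamma> * A) (\<gamma> + C)
      ((\<gamma> * A\<^sup>2 / 2 + \<beta> * A) * z + (\<gamma>\<^sup>2 * A / 2 + \<gamma> * B) * cnj z + \<delta> + D) x" .
qed

lemma g_0: "g 0 0 0 0 = id"
  by (simp add: fun_eq_iff g_apply adag.expo_0 h.expo_0 a.expo_0 E.expo_0)

text \<open>The parameters of the left factor come from solving \<open>g_mult\<close> for the
  identity, one coordinate after the other. The first three are real whenever \<open>u\<close>,
  \<open>v\<close>, \<open>w\<close> are, which yields inverses in the real family as well.\<close>

lemma g_inverse:
  "g (- u) (u * w - v) (- w) ((u * v - u\<^sup>2 * w / 2) * z + (v * w - u * w\<^sup>2 / 2) * cnj z - y) \<circ>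
    g u v w y = id"
proof -
  have "((- w * u\<^sup>2 / 2 + (u * w - v) * u) * z + ((- w)\<^sup>2 * u / 2 + - w * v) * cnj z +
      ((u * v - u\<^sup>2 * w / 2) * z + (v * w - u * w\<^sup>2 / 2) * cnj z - y) + y) = 0"
    by (simp add: field_simps power2_eq_square)
  then show ?thesis
    by (simp add: g_mult g_0[symmetric] mult.commute)
qed

lemma group_CE_family: "group (operator_monoid (CE_family a adag h E))"
proof (rule groupI)
  show "\<exists>S \<in> carrier (operator_monoid (CE_family a adag h E)).
      S \<otimes>\<^bsub>operator_monoid (CE_family a adag h E)\<^esub> T = \<one>\<^bsub>operator_monoid (CE_family a adag h E)\<^esub>"
    if "T \<in> carrier (operator_monoid (CE_family a adag h E))" for T
    using that g_inverse by (fastforce simp: operator_monoid_def CE_family_def)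
  show "\<one>\<^bsub>operator_monoid (CE_family a adag h E)\<^esub> \<in> carrier (operator_monoid (CE_family a adag h E))"
    unfolding operator_monoid_def CE_family_def using g_0[symmetric] by auto
qed (auto simp: operator_monoid_def CE_family_def g_mult comp_assoc, blast)

lemma subgroup_CE_real_family:
  "subgroup (CE_real_family a adag h E) (operator_monoid (CE_family a adag h E))"
    (is "subgroup ?R ?G")
proof -
  interpret group ?G
    by (rule group_CE_family)
  have sub: "?R \<subseteq> carrier ?G"
    by (auto simp: operator_monoid_def CE_family_def CE_real_family_def)
  show ?thesis
  proof (rule subgroupI)
    show "?R \<noteq> {}"
      unfolding CE_real_family_def using Reals_0 by blast
    show "inv\<^bsub>?G\<^esub> T \<in> ?R" if T_in: "T \<in> ?R" for T
    proof -
      obtain u v w y where T: "T = g u v w y" and real: "u \<in> \<real>" "v \<in> \<real>" "w \<in> \<real>"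
        using T_in by (auto simp: CE_real_family_def)
      define S where
        "S = g (- u) (u * w - v) (- w) ((u * v - u\<^sup>2 * w / 2) * z + (v * w - u * w\<^sup>2 / 2) * cnj z - y)"
      have "- u \<in> \<real>" "u * w - v \<in> \<real>" "- w \<in> \<real>"
        using real by auto
      then have S: "S \<in> ?R"
        unfolding S_def CE_real_family_def by blast
      have "S \<otimes>\<^bsub>?G\<^esub> T = \<one>\<^bsub>?G\<^esub>"
        unfolding S_def T by (simp add: operator_monoid_def g_inverse)
      then have "inv\<^bsub>?G\<^esub> T = S"
        using S T_in sub by (intro inv_equality) auto
      with S show ?thesis
        by simp
    qed
    show "S \<otimes>\<^bsub>?G\<^esub> T \<in> ?R" if S_in: "S \<in> ?R" and T_in: "T \<in> ?R" for S T
    proof -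
      obtain \<alpha> \<beta> \<gamma> \<delta> A B C D where S: "S = g \<alpha> \<beta> \<gamma> \<delta>" and T: "T = g A B C D"
        and real: "\<alpha> \<in> \<real>" "\<beta> \<in> \<real>" "\<gamma> \<in> \<real>" "A \<in> \<real>" "B \<in> \<real>" "C \<in> \<real>"
        using S_in T_in unfolding CE_real_family_def by blast
      have "\<alpha> + A \<in> \<real>" "\<beta> + B + \<gamma> * A \<in> \<real>" "\<gamma> + C \<in> \<real>"
        using real by auto
      then have "g \<alpha> \<beta> \<gamma> \<delta> \<circ> g A B C D \<in> ?R"
        unfolding CE_real_family_def g_mult by blast
      then show ?thesis
        by (simp add: S T operator_monoid_def)
    qed
  qed (rule sub)
qed

end

text \<open>The group axioms are checked as polynomial identities in the coordinates, so the result
  does not rest on an operator realisation.\<close>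

lemma group_CE_Heisenberg_group: "group (CE_Heisenberg_group z)"
proof (rule groupI)
  fix p :: "real \<times> real \<times> real \<times> complex"
  obtain u v w y where p: "p = (u, v, w, y)"
    by (metis prod_cases4)
  show "\<exists>q \<in> carrier (CE_Heisenberg_group z). q \<otimes>\<^bsub>CE_Heisenberg_group z\<^esub> p = \<one>\<^bsub>CE_Heisenberg_group z\<^esub>"
    \<comment> \<open>The witness is the inverse from \<open>g_inverse\<close>, read in real
      coordinates.\<close>
    by (rule bexI[of _ "(- u, u * w - v, - w, of_real (u * v - u\<^sup>2 * w / 2) * z +
        of_real (v * w - u * w\<^sup>2 / 2) * cnj z - y)"])
      (simp_all add: CE_Heisenberg_group_def p field_simps power2_eq_square)
next
  fix p q r :: "real \<times> real \<times> real \<times> complex"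
  show "p \<otimes>\<^bsub>CE_Heisenberg_group z\<^esub> q \<otimes>\<^bsub>CE_Heisenberg_group z\<^esub> r =
      p \<otimes>\<^bsub>CE_Heisenberg_group z\<^esub> (q \<otimes>\<^bsub>CE_Heisenberg_group z\<^esub> r)"
    by (cases p; cases q; cases r)
      (simp add: CE_Heisenberg_group_def field_simps power2_eq_square)
qed (auto simp: CE_Heisenberg_group_def)

theorem corollary2:
  fixes z :: complex
    and a adag h E :: "'a::complex_inner \<Rightarrow> 'a"
  assumes "z \<noteq> 0"
    and "CEHeis z a adag h E"
  shows "group (operator_monoid (CE_family a adag h E)) \<and>
    (\<forall>\<alpha> \<beta> \<gamma> \<delta> A B C D.
      CE_g a adag h E \<alpha> \<beta> \<gamma> \<delta> \<circ> CE_g a adag h E A B C D =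
      CE_g a adag h E (\<alpha> + A) (\<beta> + B + \<gamma> * A) (\<gamma> + C)
        ((\<gamma> * A\<^sup>2 / 2 + \<beta> * A) * z + (\<gamma>\<^sup>2 * A / 2 + \<gamma> * B) * cnj z + \<delta> + D)) \<and>
    subgroup (CE_real_family a adag h E) (operator_monoid (CE_family a adag h E)) \<and>
    group (CE_Heisenberg_group z)"
proof -
  interpret CEHeis z a adag h E
    by (rule assms(2))
  show ?thesis
    using group_CE_family g_mult subgroup_CE_real_family group_CE_Heisenberg_group by blast
qed

end
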